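(* Assume that $N_m\cap(p_m,\ p_{m+1}^2-4]\neq\emptyset$ for all $m\ge 0$. Then there exist infinitely many prime twins, i.e. infinitely many primes $p$ such that $p+2$ is also prime.
   Context: Let $p_0=2,\ p_1=3,\ p_2=5,\ p_3=7,\dots$ be all primes in increasing order and let $N=\{1,2,3,\dots\}$. The double sieve is defined as follows: for a prime $p$, the operator $S_p$ removes from a set of natural numbers all multiples of $p$ and, simultaneously, all numbers of the form $kp-2$. Put $N_0=S_{p_0}N$ and $N_m=S_{p_m}N_{m-1}$ for $m\ge1$. Equivalently, $N_m$ is the set of natural numbers $n\geq 1$ such that none of $p_0,\dots,p_m$ divides $n$ or $n+2$. A pair of prime twins is a pair $p,\ p+2$ with both $p$ and $p+2$ prime. *)

theory Defs
  imports "HOL-Library.Infinite_Set" "HOL-Computational_Algebra.Primes"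
begin

definition nth_prime :: "nat \<Rightarrow> nat" where
  "nth_prime m = enumerate {p. prime p} m"

(* The numbers k p - 2 are described by n + 2 = k p, which avoids truncated subtraction. *)
definition sieve_step :: "nat \<Rightarrow> nat set \<Rightarrow> nat set" where
  "sieve_step p A = A - ({n. p dvd n} \<union> {n. \<exists>k. n + 2 = k * p})"

primrec double_sieve :: "nat \<Rightarrow> nat set" where
  "double_sieve 0 = sieve_step (nth_prime 0) {1..}"
| "double_sieve (Suc m) = sieve_step (nth_prime (Suc m)) (double_sieve m)"

end

theory Submission
  imports Defs
begin

text \<open>
  The theorem is trial division applied to \<open>n\<close> and \<open>n + 2\<close> at once. A survivor \<open>n\<close> of the
  double sieve by the primes up to \<open>p\<^sub>m\<close> has the property that neither \<open>n\<close> nor \<open>n + 2\<close> has a prime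
  factor below \<open>p\<^sub>m\<^sub>+\<^sub>1\<close>. A composite number has a prime factor no larger than its square root,
  so if moreover \<open>1 < n\<close> and \<open>n + 2 < p\<^sub>m\<^sub>+\<^sub>1\<^sup>2\<close>, both numbers are prime
  (lemma \<open>double_sieve_imp_twin_primes\<close>); the window in the hypothesis guarantees these bounds. Since
  each window starts above \<open>p\<^sub>m \<ge> m\<close>, the twin primes found in this way are unbounded.
\<close>

text \<open>
  The smaller factor of a proper factorization \<open>n = a * b\<close> is at most the square root of \<open>n\<close>, and
  so is each of its prime factors.
\<close>
lemma prime_if_no_prime_factor_below_root:
  fixes n x :: nat
  assumes "1 < n" "n < x\<^sup>2" and no_factor: "\<And>q. prime q \<Longrightarrow> q < x \<Longrightarrow> \<not> q dvd n"
  shows "prime n"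
proof (rule ccontr)
  assume "\<not> prime n"
  then obtain a where a: "a dvd n" "a \<noteq> 1" "a \<noteq> n"
    using \<open>1 < n\<close> unfolding prime_nat_iff by blast
  then obtain b where b: "n = a * b"
    by (elim dvdE)
  have "a \<noteq> 0" "b \<noteq> 0" "b \<noteq> 1"
    using a(3) b \<open>1 < n\<close> by (auto intro!: Nat.gr0I)
  then have ab: "n = a * b" "1 < a" "1 < b"
    using a(2) b by linarith+
  define c where "c = min a b"
  have "c dvd n" "c \<noteq> 1"
    using ab by (auto simp: c_def min_def)
  have "c\<^sup>2 \<le> n"
    unfolding ab(1) power2_eq_square c_def by (intro mult_mono) auto
  then have "c < x"
    using \<open>n < x\<^sup>2\<close> by (meson le_less_trans power_less_imp_less_base zero_le)
  obtain q where q: "prime q" "q dvd c"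
    using \<open>c \<noteq> 1\<close> prime_factor_nat by blast
  have "q \<le> c"
    using q(2) ab by (intro dvd_imp_le) (auto simp: c_def)
  then show False
    using no_factor[OF q(1)] dvd_trans[OF q(2) \<open>c dvd n\<close>] \<open>c < x\<close> by simp
qed

lemma prime_less_nth_prime_SucE:
  assumes "prime q" "q < nth_prime (Suc m)"
  obtains i where "i \<le> m" "q = nth_prime i"
proof -
  obtain i where i: "q = nth_prime i"
    using enumerate_Ex[of "{p. prime p}" q] primes_infinite assms(1)
    unfolding nth_prime_def by auto
  with assms(2) have "i < Suc m"
    unfolding nth_prime_def using enumerate_mono_iff[OF primes_infinite] by simp
  with i that[of i] show thesis by simp
qed

lemma le_nth_prime: "m \<le> nth_prime m"
  unfolding nth_prime_def by (rule le_enumerate[OF primes_infinite])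

lemma double_sieve_not_dvd:
  assumes "n \<in> double_sieve m" "i \<le> m"
  shows "\<not> nth_prime i dvd n \<and> \<not> nth_prime i dvd n + 2"
  using assms
proof (induction m)
  case 0
  then show ?case
    by (simp add: sieve_step_def dvd_def mult.commute)
next
  case (Suc m)
  show ?case
  proof (cases "i = Suc m")
    case True
    with Suc.prems(1) show ?thesis
      by (simp add: sieve_step_def dvd_def mult.commute)
  next
    case False
    with Suc show ?thesis
      by (simp add: sieve_step_def)
  qed
qed

text \<open>
  Trial division by the sieving primes certifies both numbers: the upper end of the window keeps both \<open>n\<close> and
  \<open>n + 2\<close> below the square of the first prime not yet sieved by.
\<close>
lemma double_sieve_imp_twin_primes:
  assumes sieve: "n \<in> double_sieve m"
    and window: "nth_prime m < n" "n \<le> (nth_prime (Suc m))\<^sup>2 - 4"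
  shows "prime n" "prime (n + 2)"
proof -
  have unsieved: "\<not> q dvd n \<and> \<not> q dvd n + 2" if "prime q" "q < nth_prime (Suc m)" for q
    using that double_sieve_not_dvd[OF sieve] by (auto elim: prime_less_nth_prime_SucE)
  have "prime (nth_prime m)"
    using enumerate_in_set[OF primes_infinite] by (simp add: nth_prime_def)
  \<comment> \<open>The lower end of the window matters here: 1 itself survives sieving by 2 alone.\<close>
  then have "1 < n"
    using window(1) prime_gt_1_nat[of "nth_prime m"] by linarith
  \<comment> \<open>Since \<open>0 < n\<close>, the upper end of the window is positive, so its subtraction is not truncated.\<close>
  then have "n + 2 < (nth_prime (Suc m))\<^sup>2"
    using window(2) by linarith
  then show "prime n" "prime (n + 2)"
    using unsieved \<open>1 < n\<close>
    by (auto intro: prime_if_no_prime_factor_below_root[of _ "nth_prime (Suc m)"] simp del: add_2_eq_Suc')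
qed

(* The subtraction of 4 does not truncate, since nth_prime (Suc m) is at least 3. *)
theorem theorem4p1:
  assumes "\<And>m. double_sieve m \<inter> {nth_prime m <.. (nth_prime (Suc m))\<^sup>2 - 4} \<noteq> {}"
  shows "infinite {p :: nat. prime p \<and> prime (p + 2)}"
  unfolding infinite_nat_iff_unbounded
proof
  fix m
  obtain n where n: "n \<in> double_sieve m" "nth_prime m < n" "n \<le> (nth_prime (Suc m))\<^sup>2 - 4"
    using assms[of m] by auto
  have "m < n"
    using le_nth_prime[of m] n(2) by simp
  moreover have "n \<in> {p. prime p \<and> prime (p + 2)}"
    using double_sieve_imp_twin_primes[OF n] by simp
  ultimately show "\<exists>n>m. n \<in> {p. prime p \<and> prime (p + 2)}"
    by blast
qed

end
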